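(* Let $F$ be an ordered field with an integer part $I$, and let $\alpha,\beta\in F$ with $\alpha,\beta>1$. Then $N_{\alpha}\neq N_{\beta}$ in each of the following cases: (1) $\alpha,\beta$ are distinct irrationals; (2) $\alpha,\beta$ are distinct rationals.
   Context: A subring $I$ of an ordered field $F$ is an integer part of $F$ if $I$ is discretely ordered (no $x\in I$ satisfies $0<x<1$) and for every $x\in F$ there is a (necessarily unique) $a\in I$ with $a\leqslant x<a+1$; this $a$ is denoted $\lfloor x\rfloor$. $I^{\geqslant 0}=\{x\in I: x\geqslant 0\}$. An element of $F$ is rational if it lies in the fraction field $\mathrm{Frac}(I)\subseteq F$, and irrational otherwise. For $\alpha\in F$ positive, $N_\alpha=\{\lfloor n\alpha\rfloor : n\in I^{\geqslant 0}\}$. *)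

theory Defs
  imports Main
begin

text \<open>Subrings are unital, and are represented by their carrier set in the ambient type.\<close>

definition subring_set :: "'a::ring_1 set \<Rightarrow> bool" where
  "subring_set R \<longleftrightarrow>
     0 \<in> R \<and> 1 \<in> R \<and>
     (\<forall>x\<in>R. \<forall>y\<in>R. x + y \<in> R) \<and>
     (\<forall>x\<in>R. - x \<in> R) \<and>
     (\<forall>x\<in>R. \<forall>y\<in>R. x * y \<in> R)"

definition integer_part :: "'a::linordered_field set \<Rightarrow> bool" where
  "integer_part I \<longleftrightarrow>
     subring_set I \<and>
     \<not> (\<exists>x\<in>I. 0 < x \<and> x < 1) \<and>
     (\<forall>x. \<exists>a\<in>I. a \<le> x \<and> x < a + 1)"

text \<open>
  The library floor is only available in Archimedean fields. The floor relative to an integer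
  part is a definite description, justified by the unique existence proved below.
\<close>

definition floor_in :: "'a::linordered_field set \<Rightarrow> 'a \<Rightarrow> 'a" where
  "floor_in I x = (THE a. a \<in> I \<and> a \<le> x \<and> x < a + 1)"

definition frac_field :: "'a::linordered_field set \<Rightarrow> 'a set" where
  "frac_field I = {a / b | a b. a \<in> I \<and> b \<in> I \<and> b \<noteq> 0}"

definition rational_in :: "'a::linordered_field set \<Rightarrow> 'a \<Rightarrow> bool" where
  "rational_in I x \<longleftrightarrow> x \<in> frac_field I"

definition irrational_in :: "'a::linordered_field set \<Rightarrow> 'a \<Rightarrow> bool" where
  "irrational_in I x \<longleftrightarrow> \<not> rational_in I x"

definition beatty_set :: "'a::linordered_field set \<Rightarrow> 'a \<Rightarrow> 'a set" where
  "beatty_set I \<alpha> = {floor_in I (n * \<alpha>) | n. n \<in> I \<and> 0 \<le> n}"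

lemma integer_part_ex1:
  assumes "integer_part I"
  shows "\<exists>!a. a \<in> I \<and> a \<le> x \<and> x < a + 1"
proof -
  obtain a where a: "a \<in> I" "a \<le> x" "x < a + 1"
    using assms unfolding integer_part_def by blast
  have le: "c \<le> b" if b: "b \<in> I" "x < b + 1" and c: "c \<in> I" "c \<le> x" for b c
  proof (rule ccontr)
    assume "\<not> c \<le> b"
    then have "0 < c + - b" "c + - b < 1"
      using b c by auto
    moreover have "c + - b \<in> I"
      using assms b c unfolding integer_part_def subring_set_def by blast
    ultimately show False
      using assms unfolding integer_part_def by blast
  qed
  show ?thesis
    using a le by (intro ex1I[of _ a]) (auto intro: antisym)
qed

lemma floor_in_props:
  assumes "integer_part I"
  shows "floor_in I x \<in> I" "floor_in I x \<le> x" "x < floor_in I x + 1"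
  using theI'[OF integer_part_ex1[OF assms, of x]] unfolding floor_in_def by auto

end

theory Submission
  imports Defs
begin

text \<open>
  Counting the elements of a Beatty set below a bound is meaningless over an integer part that
  lacks induction, so the proof separates the two sets pointwise. Let \<open>1 < \<alpha> < \<beta>\<close>.

  If the Beatty sets agree, then each multiple of \<open>\<alpha>\<close> shares a unit interval with some multiple
  of \<open>\<beta>\<close>, so their distance is less than \<open>1\<close>. Dividing by \<open>\<beta>\<close>, each multiple of the
  ratio \<open>\<alpha> / \<beta>\<close>, equivalently of \<open>\<eta> = 1 - \<alpha> / \<beta>\<close>, lies within \<open>1 / \<beta>\<close> of an integer. But
  the multiples of \<open>\<eta>\<close> advance in steps of size \<open>\<eta>\<close>, and when \<open>2 \<le> \<alpha>\<close> such a step is too short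
  to jump over the gap between \<open>1 / \<beta>\<close> and \<open>1 - 1 / \<beta>\<close>
  (lemma \<open>multiple_far_from_multiples\<close>). This settles \<open>2 \<le> \<alpha>\<close>. If \<open>\<alpha> < 2 \<le> \<beta>\<close>, the
  number \<open>1\<close> tells the sets apart.

  If \<open>\<beta> < 2\<close>, one passes to complements. As in Beatty's theorem, the complement of the
  Beatty set of \<open>\<alpha>\<close> is given by the multiples of the conjugate \<open>\<alpha> / (\<alpha> - 1)\<close>, now with
  unit intervals closed on the right, which makes the statement true for rational \<open>\<alpha>\<close> as well
  (lemma \<open>not_in_beatty_set_iff\<close>). Conjugation reverses the order and sends numbers below \<open>2\<close>
  to numbers above \<open>2\<close>, so the gap argument applies to the conjugates.
\<close>

lemma integer_part_closed:
  assumes "integer_part I"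
  shows "0 \<in> I" "1 \<in> I"
    and "\<And>x y. x \<in> I \<Longrightarrow> y \<in> I \<Longrightarrow> x + y \<in> I"
    and "\<And>x y. x \<in> I \<Longrightarrow> y \<in> I \<Longrightarrow> x - y \<in> I"
    and "\<And>x. x \<in> I \<Longrightarrow> - x \<in> I"
proof -
  have add: "x + y \<in> I" and minus: "- x \<in> I" if "x \<in> I" "y \<in> I" for x y
    using assms that unfolding integer_part_def subring_set_def by blast+
  show "x - y \<in> I" if "x \<in> I" "y \<in> I" for x y
    using add[of x "- y"] minus[of y] that by simp
  show "0 \<in> I" "1 \<in> I"
    using assms unfolding integer_part_def subring_set_def by blast+
qed (use assms in \<open>auto simp: integer_part_def subring_set_def\<close>)

lemma integer_part_less_imp_add_one_le:
  assumes "integer_part I" "a \<in> I" "b \<in> I" "a < b"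
  shows "a + 1 \<le> b"
proof (rule ccontr)
  assume "\<not> a + 1 \<le> b"
  then have "0 < b - a" "b - a < 1"
    using assms(4) by (auto simp: algebra_simps)
  moreover have "b - a \<in> I"
    using integer_part_closed(4)[OF assms(1)] assms by blast
  ultimately show False
    using assms(1) unfolding integer_part_def by blast
qed

lemma integer_part_ceiling:
  assumes "integer_part I"
  obtains p where "p \<in> I" "p - 1 < x" "x \<le> p"
proof -
  have "- floor_in I (- x) \<in> I" "- floor_in I (- x) - 1 < x" "x \<le> - floor_in I (- x)"
    using floor_in_props[OF assms, of "- x"] integer_part_closed(5)[OF assms]
    by (auto simp: algebra_simps)
  then show thesis by (rule that)
qed

lemma mem_beatty_set_iff:
  assumes "integer_part I"
  shows "m \<in> beatty_set I \<alpha> \<longleftrightarrow> m \<in> I \<and> (\<exists>n\<in>I. 0 \<le> n \<and> m \<le> n * \<alpha> \<and> n * \<alpha> < m + 1)"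
  unfolding beatty_set_def
  using floor_in_props[OF assms] integer_part_ex1[OF assms] by blast

text \<open>
  In units of \<open>b\<close>, the multiples of \<open>a\<close> drift away from the integers in steps of size
  \<open>1 - a / b\<close>; the last multiple before the drift exceeds \<open>1 - 1 / b\<close> has a drift above
  \<open>1 / b\<close>, because \<open>2 \<le> a\<close> bounds the step by \<open>1 - 2 / b\<close>.
\<close>
lemma multiple_far_from_multiples:
  assumes I: "integer_part I" and "2 \<le> a" "a < b"
  shows "\<exists>n\<in>I. 0 < n \<and> (\<forall>k\<in>I. 1 \<le> \<bar>n * a - k * b\<bar>)"
proof -
  define n where "n = floor_in I ((b - 1) / (b - a))"
  have pos: "0 < b - a" using assms by simp
  have nI: "n \<in> I" and "n \<le> (b - 1) / (b - a)" "(b - 1) / (b - a) < n + 1"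
    using floor_in_props[OF I] by (auto simp: n_def)
  then have le: "n * (b - a) \<le> b - 1" and "b - 1 < (n + 1) * (b - a)"
    using pos by (simp_all add: pos_le_divide_eq pos_divide_less_eq)
  then have gt: "1 < n * (b - a)"
    using \<open>2 \<le> a\<close> by (simp add: algebra_simps)
  then have "0 < n * (b - a)" by (rule less_trans[OF zero_less_one])
  then have npos: "0 < n"
    using pos by (simp add: zero_less_mult_iff)
  have "1 \<le> \<bar>n * a - k * b\<bar>" if k: "k \<in> I" for k
  proof (cases "n \<le> k")
    case True
    then have "n * b \<le> k * b"
      using assms by (intro mult_right_mono) auto
    then have "n * a - k * b \<le> - 1"
      using gt by (simp add: algebra_simps)
    then show ?thesis by linarith
  next
    case False
    then have "k + 1 \<le> n"
      using integer_part_less_imp_add_one_le[OF I k nI] by simp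
    then have "(k + 1) * b \<le> n * b"
      using assms by (intro mult_right_mono) auto
    then have "1 \<le> n * a - k * b"
      using le by (simp add: algebra_simps)
    then show ?thesis by linarith
  qed
  then show ?thesis using nI npos by blast
qed

text \<open>
  If \<open>p \<alpha>\<close> is the first multiple of \<open>\<alpha>\<close> that is at least \<open>m\<close>, then \<open>m\<close> is missed exactly when
  \<open>(p - 1) \<alpha> < m\<close> and \<open>m + 1 \<le> p \<alpha>\<close>. With \<open>k = m + 1 - p\<close> these two inequalities become the
  ones on the right.
\<close>
lemma not_in_beatty_set_iff:
  assumes I: "integer_part I" and "1 < \<alpha>" and m: "m \<in> I" "0 \<le> m"
  shows "m \<notin> beatty_set I \<alpha> \<longleftrightarrow> (\<exists>k\<in>I. m < k * (\<alpha> / (\<alpha> - 1)) \<and> k * (\<alpha> / (\<alpha> - 1)) \<le> m + 1)"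
proof -
  have conj: "m < (m + 1 - p) * (\<alpha> / (\<alpha> - 1)) \<longleftrightarrow> (p - 1) * \<alpha> < m"
    "(m + 1 - p) * (\<alpha> / (\<alpha> - 1)) \<le> m + 1 \<longleftrightarrow> m + 1 \<le> p * \<alpha>" for p
    using \<open>1 < \<alpha>\<close> by (auto simp: field_simps)
  show ?thesis
  proof
    assume notin: "m \<notin> beatty_set I \<alpha>"
    obtain p where p: "p \<in> I" "p - 1 < m / \<alpha>" "m / \<alpha> \<le> p"
      using integer_part_ceiling[OF I] .
    have "0 \<le> m / \<alpha>" using m assms by simp
    then have "0 \<le> p" using p(3) by (rule order_trans)
    moreover have "m \<le> p * \<alpha>" and less: "(p - 1) * \<alpha> < m"
      using p \<open>1 < \<alpha>\<close> by (simp_all add: pos_divide_le_eq pos_less_divide_eq)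
    ultimately have "m + 1 \<le> p * \<alpha>"
      using notin p(1) m unfolding mem_beatty_set_iff[OF I] by (meson not_le)
    moreover have "m + 1 - p \<in> I"
      using p(1) m integer_part_closed[OF I] by blast
    ultimately show "\<exists>k\<in>I. m < k * (\<alpha> / (\<alpha> - 1)) \<and> k * (\<alpha> / (\<alpha> - 1)) \<le> m + 1"
      using less conj by blast
  next
    assume "\<exists>k\<in>I. m < k * (\<alpha> / (\<alpha> - 1)) \<and> k * (\<alpha> / (\<alpha> - 1)) \<le> m + 1"
    then obtain k where k: "k \<in> I" "m < k * (\<alpha> / (\<alpha> - 1))" "k * (\<alpha> / (\<alpha> - 1)) \<le> m + 1"
      by blast
    define p where "p = m + 1 - k"
    have pI: "p \<in> I"
      using k(1) m integer_part_closed[OF I] unfolding p_def by blast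
    have p: "(p - 1) * \<alpha> < m" "m + 1 \<le> p * \<alpha>"
      using k conj[of p] by (simp_all add: p_def)
    show "m \<notin> beatty_set I \<alpha>"
    proof
      assume "m \<in> beatty_set I \<alpha>"
      then obtain n where n: "n \<in> I" "m \<le> n * \<alpha>" "n * \<alpha> < m + 1"
        unfolding mem_beatty_set_iff[OF I] by blast
      have "(p - 1) * \<alpha> < n * \<alpha>" "n * \<alpha> < p * \<alpha>"
        using p n by linarith+
      then have "p - 1 < n" "n < p"
        using \<open>1 < \<alpha>\<close> by (simp_all add: mult_less_cancel_right)
      then show False
        using integer_part_less_imp_add_one_le[OF I n(1) pI] by simp
    qed
  qed
qed

lemma beatty_set_neq_of_two_le:
  assumes I: "integer_part I" and "2 \<le> \<alpha>" "\<alpha> < \<beta>"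
  shows "beatty_set I \<alpha> \<noteq> beatty_set I \<beta>"
proof
  assume eq: "beatty_set I \<alpha> = beatty_set I \<beta>"
  obtain n where n: "n \<in> I" "0 < n" and far: "\<And>k. k \<in> I \<Longrightarrow> 1 \<le> \<bar>n * \<alpha> - k * \<beta>\<bar>"
    using multiple_far_from_multiples[OF assms] by blast
  define m where "m = floor_in I (n * \<alpha>)"
  have m: "m \<le> n * \<alpha>" "n * \<alpha> < m + 1"
    using floor_in_props[OF I] by (auto simp: m_def)
  have "m \<in> beatty_set I \<alpha>"
    using n unfolding m_def beatty_set_def by force
  then obtain k where "k \<in> I" "m \<le> k * \<beta>" "k * \<beta> < m + 1"
    unfolding eq mem_beatty_set_iff[OF I] by blast
  with m have "\<bar>n * \<alpha> - k * \<beta>\<bar> < 1" by linarith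
  then show False using far[OF \<open>k \<in> I\<close>] by simp
qed

lemma beatty_set_neq_of_less_two:
  assumes I: "integer_part I" and "1 < \<alpha>" "\<alpha> < \<beta>" "\<beta> < 2"
  shows "beatty_set I \<alpha> \<noteq> beatty_set I \<beta>"
proof
  assume eq: "beatty_set I \<alpha> = beatty_set I \<beta>"
  define a b where "a = \<alpha> / (\<alpha> - 1)" and "b = \<beta> / (\<beta> - 1)"
  have "2 \<le> b" "b < a"
    using assms by (auto simp: a_def b_def field_simps)
  then obtain n where n: "n \<in> I" "0 < n" and far: "\<And>k. k \<in> I \<Longrightarrow> 1 \<le> \<bar>n * b - k * a\<bar>"
    using multiple_far_from_multiples[OF I] by blast
  obtain p where p: "p \<in> I" "p - 1 < n * b" "n * b \<le> p"
    using integer_part_ceiling[OF I] .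
  define m where "m = p - 1"
  have "0 < n * b" using n \<open>2 \<le> b\<close> by simp
  then have "0 < p" using p(3) by (rule less_le_trans)
  then have "0 \<le> m"
    using integer_part_less_imp_add_one_le[OF I integer_part_closed(1)[OF I] p(1)]
    by (simp add: m_def)
  have mI: "m \<in> I"
    using p(1) integer_part_closed[OF I] unfolding m_def by blast
  have m: "m < n * b" "n * b \<le> m + 1"
    using p by (simp_all add: m_def)
  have "m \<notin> beatty_set I \<beta>"
    using not_in_beatty_set_iff[OF I _ mI \<open>0 \<le> m\<close>, of \<beta>] m n(1) assms
    unfolding b_def by force
  then have "m \<notin> beatty_set I \<alpha>" by (simp add: eq)
  then obtain k where "k \<in> I" "m < k * a" "k * a \<le> m + 1"
    using not_in_beatty_set_iff[OF I \<open>1 < \<alpha>\<close> mI \<open>0 \<le> m\<close>] unfolding a_def by blast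
  with m have "\<bar>n * b - k * a\<bar> < 1" by linarith
  then show False using far[OF \<open>k \<in> I\<close>] by simp
qed

lemma one_in_beatty_set_iff:
  assumes I: "integer_part I" and "1 < \<alpha>"
  shows "1 \<in> beatty_set I \<alpha> \<longleftrightarrow> \<alpha> < 2"
proof
  assume "1 \<in> beatty_set I \<alpha>"
  then obtain n where n: "n \<in> I" "0 \<le> n" "1 \<le> n * \<alpha>" "n * \<alpha> < 2"
    unfolding mem_beatty_set_iff[OF I] by auto
  then have "n \<noteq> 0" by auto
  then have "1 \<le> n"
    using integer_part_less_imp_add_one_le[OF I integer_part_closed(1)[OF I] n(1)] n(2) by simp
  then have "1 * \<alpha> \<le> n * \<alpha>"
    using \<open>1 < \<alpha>\<close> by (intro mult_right_mono) auto
  with n show "\<alpha> < 2" by simp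
next
  assume "\<alpha> < 2"
  then show "1 \<in> beatty_set I \<alpha>"
    using assms integer_part_closed(2)[OF I] unfolding mem_beatty_set_iff[OF I]
    by (auto intro!: bexI[of _ 1])
qed

lemma beatty_set_neq_of_less:
  assumes I: "integer_part I" and "1 < \<alpha>" "\<alpha> < \<beta>"
  shows "beatty_set I \<alpha> \<noteq> beatty_set I \<beta>"
proof -
  consider "2 \<le> \<alpha>" | "\<alpha> < 2" "2 \<le> \<beta>" | "\<beta> < 2" by linarith
  then show ?thesis
  proof cases
    case 2
    then show ?thesis
      using one_in_beatty_set_iff[OF I, of \<alpha>] one_in_beatty_set_iff[OF I, of \<beta>] assms by auto
  qed (use beatty_set_neq_of_two_le beatty_set_neq_of_less_two assms in blast)+
qed

theorem theorem2p8:
  fixes I :: "'a::linordered_field set"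
    and \<alpha> \<beta> :: 'a
  assumes "integer_part I"
    and "\<alpha> > 1" and "\<beta> > 1"
  shows "(irrational_in I \<alpha> \<and> irrational_in I \<beta> \<and> \<alpha> \<noteq> \<beta> \<longrightarrow> beatty_set I \<alpha> \<noteq> beatty_set I \<beta>) \<and>
         (rational_in I \<alpha> \<and> rational_in I \<beta> \<and> \<alpha> \<noteq> \<beta> \<longrightarrow> beatty_set I \<alpha> \<noteq> beatty_set I \<beta>)"
proof -
  have "beatty_set I \<alpha> \<noteq> beatty_set I \<beta>" if "\<alpha> \<noteq> \<beta>"
    using that beatty_set_neq_of_less[of I \<alpha> \<beta>] beatty_set_neq_of_less[of I \<beta> \<alpha>] assms
    by (metis linorder_less_linear)
  then show ?thesis by blast
qed

end
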